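(* Let $G$ be a group acting on a set $X$. Let $\tau\in\mathrm{End}_G(X)$ be an elementary collapsing of type $(H,[K]_{N_H})$, and let $\eta\in\mathrm{End}_G(X)$ be such that $\tau\sim_{\mathcal{L}}\eta$. Then $\eta$ is an elementary collapsing of the same type $(H,[K]_{N_H})$.
   Context: $\mathrm{End}_G(X)$ is the monoid, under composition $(fg)(x)=f(g(x))$, of all $G$-equivariant functions $X\to X$. Write $S=\mathrm{End}_G(X)$. For $a,b\in S$, $a\sim_{\mathcal{L}} b$ means $Sa=Sb$, where $Sa=\{sa : s\in S\}$. $G_x$ is the stabilizer and $Gx$ the orbit of $x$. The kernel of $f:X\to X$ is $\ker(f)=\{(x,y)\in X\times X : f(x)=f(y)\}$. For a subgroup $K\le G$ and a subset $N\subseteq G$, $[K]_N=\{n^{-1}Kn : n\in N\}$; $N_H=N_G(H)$ is the normalizer of a subgroup $H\le G$. Definition. For subgroups $H,K\le G$, $\tau\in\mathrm{End}_G(X)$ is an elementary collapsing of type $(H,[K]_{N_H})$ if there exist $x,y\in X$ such that: (i) $Gx\neq Gy$; (ii) $G_x=H$; (iii) $[G_y]_{N_H}=[G_{\tau(x)}]_{N_H}=[K]_{N_H}$; (iv) $\ker(\tau)=\{(a,a): a\in X\}\cup\{(g\cdot x,g\cdot y),(g\cdot y,g\cdot x): g\in G\}\cup\{(g\cdot x,h\cdot x),(h\cdot x,g\cdot x): g,h\in G,\ h^{-1}g\in G_y\}$. *)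

theory Defs
  imports "HOL-Algebra.Group_Action"
begin

text \<open>As for \<^const>\<open>BijGroup\<close>, self-maps of \<open>X\<close> are represented by extensional functions,
  so that equality in the carrier is equality of functions \<open>X \<rightarrow> X\<close>.\<close>

definition End_action ::
  "('g, 'm) monoid_scheme \<Rightarrow> 'x set \<Rightarrow> ('g \<Rightarrow> 'x \<Rightarrow> 'x) \<Rightarrow> ('x \<Rightarrow> 'x) monoid" where
  "End_action G X \<phi> =
     \<lparr>carrier = {f \<in> X \<rightarrow>\<^sub>E X. \<forall>g \<in> carrier G. \<forall>x \<in> X. f (\<phi> g x) = \<phi> g (f x)},
      mult = compose X,
      one = (\<lambda>x \<in> X. x)\<rparr>"

definition left_ideal :: "('a, 'm) monoid_scheme \<Rightarrow> 'a \<Rightarrow> 'a set" where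
  "left_ideal S a = {s \<otimes>\<^bsub>S\<^esub> a | s. s \<in> carrier S}"

definition L_related :: "('a, 'm) monoid_scheme \<Rightarrow> 'a \<Rightarrow> 'a \<Rightarrow> bool" where
  "L_related S a b \<longleftrightarrow> left_ideal S a = left_ideal S b"

definition kernel_on :: "'x set \<Rightarrow> ('x \<Rightarrow> 'x) \<Rightarrow> ('x \<times> 'x) set" where
  "kernel_on X f = {(x, y). x \<in> X \<and> y \<in> X \<and> f x = f y}"

definition conj_class :: "('g, 'm) monoid_scheme \<Rightarrow> 'g set \<Rightarrow> 'g set \<Rightarrow> 'g set set" where
  "conj_class G N K = {inv\<^bsub>G\<^esub> n <#\<^bsub>G\<^esub> K #>\<^bsub>G\<^esub> n | n. n \<in> N}"

text \<open>An elementary collapsing of type \<open>(H, [K]\<^bsub>N\<^esub>)\<close> with \<open>N\<close> the normalizer of \<open>H\<close>;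
  the type depends on \<open>K\<close> only through its conjugacy class under \<open>N\<close>.\<close>

definition elementary_collapsing ::
  "('g, 'm) monoid_scheme \<Rightarrow> 'x set \<Rightarrow> ('g \<Rightarrow> 'x \<Rightarrow> 'x) \<Rightarrow> 'g set \<Rightarrow> 'g set \<Rightarrow> ('x \<Rightarrow> 'x) \<Rightarrow> bool"
  where
  "elementary_collapsing G X \<phi> H K \<tau> \<longleftrightarrow>
     subgroup H G \<and> subgroup K G \<and> \<tau> \<in> carrier (End_action G X \<phi>) \<and>
     (\<exists>x \<in> X. \<exists>y \<in> X.
        orbit G \<phi> x \<noteq> orbit G \<phi> y \<and>
        stabilizer G \<phi> x = H \<and>
        conj_class G (normalizer G H) (stabilizer G \<phi> y) = conj_class G (normalizer G H) K \<and>
        conj_class G (normalizer G H) (stabilizer G \<phi> (\<tau> x)) = conj_class G (normalizer G H) K \<and>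
        kernel_on X \<tau> =
          {(a, a) | a. a \<in> X} \<union>
          ({(\<phi> g x, \<phi> g y) | g. g \<in> carrier G} \<union> {(\<phi> g y, \<phi> g x) | g. g \<in> carrier G}) \<union>
          ({(\<phi> g x, \<phi> h x) | g h. g \<in> carrier G \<and> h \<in> carrier G \<and>
              inv\<^bsub>G\<^esub> h \<otimes>\<^bsub>G\<^esub> g \<in> stabilizer G \<phi> y} \<union>
           {(\<phi> h x, \<phi> g x) | g h. g \<in> carrier G \<and> h \<in> carrier G \<and>
              inv\<^bsub>G\<^esub> h \<otimes>\<^bsub>G\<^esub> g \<in> stabilizer G \<phi> y}))"

lemma (in group_action) monoid_End_action: "monoid (End_action G E \<phi>)"
proof
  have inE: "\<phi> g x \<in> E" if "g \<in> carrier G" "x \<in> E" for g x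
    using that element_image by blast
  show "a \<otimes>\<^bsub>End_action G E \<phi>\<^esub> b \<in> carrier (End_action G E \<phi>)"
    if "a \<in> carrier (End_action G E \<phi>)" "b \<in> carrier (End_action G E \<phi>)" for a b
    using that inE by (auto simp: End_action_def compose_def PiE_iff)
  show "a \<otimes>\<^bsub>End_action G E \<phi>\<^esub> b \<otimes>\<^bsub>End_action G E \<phi>\<^esub> c =
      a \<otimes>\<^bsub>End_action G E \<phi>\<^esub> (b \<otimes>\<^bsub>End_action G E \<phi>\<^esub> c)"
    if "a \<in> carrier (End_action G E \<phi>)" "b \<in> carrier (End_action G E \<phi>)"
      "c \<in> carrier (End_action G E \<phi>)" for a b c
    using that by (auto simp: End_action_def compose_def PiE_iff fun_eq_iff)
  show "\<one>\<^bsub>End_action G E \<phi>\<^esub> \<in> carrier (End_action G E \<phi>)"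
    using inE by (auto simp: End_action_def)
  show "\<one>\<^bsub>End_action G E \<phi>\<^esub> \<otimes>\<^bsub>End_action G E \<phi>\<^esub> a = a"
    "a \<otimes>\<^bsub>End_action G E \<phi>\<^esub> \<one>\<^bsub>End_action G E \<phi>\<^esub> = a"
    if "a \<in> carrier (End_action G E \<phi>)" for a
    using that by (auto simp: End_action_def compose_def PiE_iff fun_eq_iff extensional_def)
qed

end

theory Submission
  imports Defs
begin

text \<open>Besides membership in the endomorphism monoid, an elementary collapsing is described by
  its kernel and the stabilizers of its values alone, and both are invariants of the L-class. Indeed
  L-related \<open>a\<close> and \<open>b\<close> factor through each other on the left, a = s b and
  b = t a. Left factors can only enlarge kernels and, being equivariant, stabilizers of values; both
  directions together give equality (\<open>L_related_kernel_eq\<close>,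
  \<open>L_related_stabilizer_eq\<close>). The points x, y that witness the type of \<tau> therefore
  serve for \<eta> as well.\<close>

lemma (in monoid) L_relatedD:
  assumes "L_related G a b" and "a \<in> carrier G"
  obtains s where "s \<in> carrier G" and "a = s \<otimes> b"
proof -
  \<comment> \<open>The unit places \<open>a\<close> in its own left ideal, hence in that of
    \<open>b\<close>.\<close>
  have "\<one> \<otimes> a \<in> left_ideal G a"
    unfolding left_ideal_def by blast
  then have "a \<in> left_ideal G b"
    using assms by (simp add: L_related_def)
  then show thesis
    using that by (auto simp: left_ideal_def)
qed

lemma L_related_sym: "L_related S a b \<Longrightarrow> L_related S b a"
  by (simp add: L_related_def)

context group_action
begin

text \<open>The product is \<open>compose E\<close>, which is genuine composition only on
  \<open>E\<close>; hence the pointwise form there.\<close>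

lemma L_related_End_factor:
  assumes "L_related (End_action G E \<phi>) a b" and "a \<in> carrier (End_action G E \<phi>)"
  obtains s where "s \<in> carrier (End_action G E \<phi>)" and "\<And>x. x \<in> E \<Longrightarrow> a x = s (b x)"
proof -
  obtain s where "s \<in> carrier (End_action G E \<phi>)" "a = compose E s b"
    using monoid.L_relatedD[OF monoid_End_action assms] by (auto simp: End_action_def)
  then show thesis
    using that by (simp add: compose_eq)
qed

lemma End_action_closed:
  assumes "f \<in> carrier (End_action G E \<phi>)" and "x \<in> E"
  shows "f x \<in> E"
  using assms by (auto simp: End_action_def)

text \<open>If g fixes x, then g s(x) = s(g x) = s(x).\<close>

lemma stabilizer_End_action_subset:
  assumes "s \<in> carrier (End_action G E \<phi>)" and "x \<in> E"
  shows "stabilizer G \<phi> x \<subseteq> stabilizer G \<phi> (s x)"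
proof
  fix g
  assume "g \<in> stabilizer G \<phi> x"
  then have "g \<in> carrier G" "\<phi> g x = x"
    by (auto simp: stabilizer_def)
  moreover have "s (\<phi> g x) = \<phi> g (s x)"
    using assms \<open>g \<in> carrier G\<close> by (simp add: End_action_def)
  ultimately show "g \<in> stabilizer G \<phi> (s x)"
    by (simp add: stabilizer_def)
qed

text \<open>Since a = s b, this is the inclusion for the equivariant map s at the point
  \<open>b x\<close>.\<close>

lemma L_related_stabilizer_subset:
  assumes "L_related (End_action G E \<phi>) a b"
    and "a \<in> carrier (End_action G E \<phi>)" and "b \<in> carrier (End_action G E \<phi>)" and "x \<in> E"
  shows "stabilizer G \<phi> (b x) \<subseteq> stabilizer G \<phi> (a x)"
proof -
  obtain s where "s \<in> carrier (End_action G E \<phi>)" "\<And>x. x \<in> E \<Longrightarrow> a x = s (b x)"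
    using L_related_End_factor[OF assms(1,2)] by blast
  then show ?thesis
    using stabilizer_End_action_subset End_action_closed assms(3,4) by simp
qed

lemma L_related_stabilizer_eq:
  assumes "L_related (End_action G E \<phi>) a b"
    and "a \<in> carrier (End_action G E \<phi>)" and "b \<in> carrier (End_action G E \<phi>)" and "x \<in> E"
  shows "stabilizer G \<phi> (a x) = stabilizer G \<phi> (b x)"
  using L_related_stabilizer_subset[OF assms]
    L_related_stabilizer_subset[OF L_related_sym[OF assms(1)] assms(3,2,4)]
  by (rule subset_antisym[rotated])

text \<open>As \<open>a\<close> factors through \<open>b\<close>, it identifies all points that
  \<open>b\<close> identifies.\<close>

lemma L_related_kernel_subset:
  assumes "L_related (End_action G E \<phi>) a b" and "a \<in> carrier (End_action G E \<phi>)"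
  shows "kernel_on E b \<subseteq> kernel_on E a"
proof -
  obtain s where "\<And>x. x \<in> E \<Longrightarrow> a x = s (b x)"
    using L_related_End_factor[OF assms] by blast
  then show ?thesis
    by (auto simp: kernel_on_def)
qed

lemma L_related_kernel_eq:
  assumes "L_related (End_action G E \<phi>) a b"
    and "a \<in> carrier (End_action G E \<phi>)" and "b \<in> carrier (End_action G E \<phi>)"
  shows "kernel_on E a = kernel_on E b"
  using L_related_kernel_subset[OF L_related_sym[OF assms(1)] assms(3)]
    L_related_kernel_subset[OF assms(1,2)]
  by (rule subset_antisym)

end

theorem theorem27:
  fixes G :: "('g, 'm) monoid_scheme"
    and X :: "'x set"
    and \<phi> :: "'g \<Rightarrow> 'x \<Rightarrow> 'x"
    and H K :: "'g set"
    and \<tau> \<eta> :: "'x \<Rightarrow> 'x"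
  assumes "group_action G X \<phi>"
    and "subgroup H G" and "subgroup K G"
    and "\<tau> \<in> carrier (End_action G X \<phi>)"
    and "elementary_collapsing G X \<phi> H K \<tau>"
    and "\<eta> \<in> carrier (End_action G X \<phi>)"
    and "L_related (End_action G X \<phi>) \<tau> \<eta>"
  shows "elementary_collapsing G X \<phi> H K \<eta>"
proof -
  interpret group_action G X \<phi> by fact
  have kernel: "kernel_on X \<eta> = kernel_on X \<tau>"
    using L_related_kernel_eq[OF assms(7,4,6)] by (rule sym)
  have stab: "stabilizer G \<phi> (\<eta> x) = stabilizer G \<phi> (\<tau> x)" if "x \<in> X" for x
    using L_related_stabilizer_eq[OF assms(7,4,6) that] by (rule sym)
  show ?thesis
    \<comment> \<open>With the kernels identified, \<eta> remains only in its membership and in the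
      stabilizer of \<open>\<eta> x\<close>. The rule \<open>bex_cong\<close> supplies the
      \<open>x \<in> X\<close> that \<open>stab\<close> requires under the quantifier.\<close>
    using assms(5) unfolding elementary_collapsing_def kernel
    by (simp only: stab assms(6) simp_thms cong: bex_cong)
qed

end
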